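(* Let $0\le\beta\le1$, let $m\in\mathbb{N}$ and let $x_1,\dots,x_m\in\mathbb{R}$ with $x_1+\cdots+x_m=x$. Then, for every $n\in\mathbb{N}_0$, $$\sum_{j_1+\cdots+j_m=n}\binom{n}{j_1,\dots,j_m}E_{j_1}(\beta;x_1)\cdots E_{j_m}(\beta;x_m)=E_n(m,\beta;x)=\sum_{k=0}^n\binom{-m}{k}\beta^k\Delta^kI_n(x).$$
   Context: $\mathbb{N}=\{1,2,\dots\}$, $\mathbb{N}_0=\mathbb{N}\cup\{0\}$. The first sum is over $j_1,\dots,j_m\in\mathbb{N}_0$, and $\binom{n}{j_1,\dots,j_m}=\frac{n!}{j_1!\cdots j_m!}$. For $t\in\mathbb{R}$ and $0\le\beta\le1$, the generalized Apostol-Euler polynomials $E_n(t,\beta;x)$ are defined by $\sum_{n\ge0}E_n(t,\beta;x)\frac{z^n}{n!}=\frac{e^{xz}}{(1+\beta(e^z-1))^t}$ for complex $z$ near $0$ (with the branch of the power equal to $1$ at $z=0$); the Apostol-Euler polynomials are $E_n(\beta;x)=E_n(1,\beta;x)$. $\Delta^kf(x)=\sum_{j=0}^k\binom{k}{j}(-1)^{k-j}f(x+j)$ and $I_n(x)=x^n$. For real $y$, $\binom{y}{k}=y(y-1)\cdots(y-k+1)/k!$; $\beta^0=1$. *)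

theory Defs
  imports "HOL-Complex_Analysis.Complex_Analysis"
begin

text \<open>
  The power is the principal one; since its base equals 1 at \<open>z = 0\<close>, this is the branch with
  value 1 there.
\<close>

definition apostol_euler_gf :: "real \<Rightarrow> real \<Rightarrow> real \<Rightarrow> complex \<Rightarrow> complex" where
  "apostol_euler_gf t \<beta> x z =
     exp (of_real x * z) / (1 + of_real \<beta> * (exp z - 1)) powr of_real t"

text \<open>
  The sequence of real numbers \<open>E\<^sub>n(t,\<beta>;x)\<close> is determined by its exponential generating function
  near 0; existence and uniqueness are proved below.
\<close>

definition gen_apostol_euler :: "nat \<Rightarrow> real \<Rightarrow> real \<Rightarrow> real \<Rightarrow> real" where
  "gen_apostol_euler n t \<beta> x =
     (THE E :: nat \<Rightarrow> real. \<forall>\<^sub>F z :: complex in nhds 0.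
        (\<lambda>n. of_real (E n) * (z ^ n / fact n)) sums apostol_euler_gf t \<beta> x z) n"

definition apostol_euler :: "nat \<Rightarrow> real \<Rightarrow> real \<Rightarrow> real" where
  "apostol_euler n \<beta> x = gen_apostol_euler n 1 \<beta> x"

definition fwd_diff :: "nat \<Rightarrow> (real \<Rightarrow> real) \<Rightarrow> real \<Rightarrow> real" where
  "fwd_diff k f x = (\<Sum>j=0..k. real (k choose j) * (-1) ^ (k - j) * f (x + real j))"

text \<open>
  The \<open>m\<close>-tuples \<open>(j\<^sub>1, \<dots>, j\<^sub>m)\<close> of naturals with sum \<open>n\<close>, as functions that are
  \<^const>\<open>undefined\<close> off \<open>{1..m}\<close> so that each tuple is represented exactly once.
\<close>

definition weak_compositions :: "nat \<Rightarrow> nat \<Rightarrow> (nat \<Rightarrow> nat) set" where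
  "weak_compositions m n = {j \<in> {1..m} \<rightarrow>\<^sub>E UNIV. (\<Sum>i=1..m. j i) = n}"

definition multinomial :: "nat \<Rightarrow> nat \<Rightarrow> (nat \<Rightarrow> nat) \<Rightarrow> real" where
  "multinomial n m j = fact n / (\<Prod>i=1..m. fact (j i))"

lemma finite_weak_compositions: "finite (weak_compositions m n)"
proof (rule finite_subset)
  show "weak_compositions m n \<subseteq> {1..m} \<rightarrow>\<^sub>E {..n}"
  proof
    fix j assume j: "j \<in> weak_compositions m n"
    have "j i \<le> n" if "i \<in> {1..m}" for i
      using j that member_le_sum[of i "{1..m}" j] by (auto simp: weak_compositions_def)
    with j show "j \<in> {1..m} \<rightarrow>\<^sub>E {..n}"
      by (auto simp: weak_compositions_def PiE_iff)
  qed
qed (simp add: finite_PiE)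

lemma sums_coeffs_unique:
  fixes a b :: "nat \<Rightarrow> complex"
  assumes "\<forall>\<^sub>F z in nhds 0. (\<lambda>n. a n * (z ^ n / fact n)) sums f z"
    and "\<forall>\<^sub>F z in nhds 0. (\<lambda>n. b n * (z ^ n / fact n)) sums f z"
  shows "a = b"
proof -
  have "f has_fps_expansion Abs_fps (\<lambda>n. a n / fact n)"
    using assms(1) by (intro has_fps_expansionI) (simp add: field_simps)
  moreover have "f has_fps_expansion Abs_fps (\<lambda>n. b n / fact n)"
    using assms(2) by (intro has_fps_expansionI) (simp add: field_simps)
  ultimately have "Abs_fps (\<lambda>n. a n / fact n) = Abs_fps (\<lambda>n. b n / fact n)"
    by (rule fps_expansion_unique_complex)
  thus ?thesis
    by (auto simp: fps_eq_iff)
qed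

lemma apostol_euler_gf_ex1:
  "\<exists>!E :: nat \<Rightarrow> real. \<forall>\<^sub>F z :: complex in nhds 0.
     (\<lambda>n. of_real (E n) * (z ^ n / fact n)) sums apostol_euler_gf t \<beta> x z"
proof -
  define b where "b = (\<lambda>z :: complex. 1 + of_real \<beta> * (exp z - 1))"
  have "isCont b 0"
    unfolding b_def by (intro continuous_intros)
  hence "\<forall>\<^sub>F z in nhds 0. b z \<in> ball 1 1"
    unfolding continuous_at_eps_delta
    by (auto simp: eventually_nhds_metric dist_commute b_def dest!: spec[of _ "1::real"])
  then obtain r where r: "r > 0" and br: "\<And>z. z \<in> ball 0 r \<Longrightarrow> b z \<in> ball 1 1"
    by (auto simp: eventually_nhds_metric dist_commute)
  have slit: "b z \<notin> \<real>\<^sub>\<le>\<^sub>0" if "z \<in> ball 0 r" for z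
  proof
    assume "b z \<in> \<real>\<^sub>\<le>\<^sub>0"
    hence "Re (b z) \<le> 0"
      by (auto elim!: nonpos_Reals_cases)
    moreover have "\<bar>Re (1 - b z)\<bar> < 1"
      using br[OF that] abs_Re_le_cmod[of "1 - b z"] by (simp add: dist_norm)
    ultimately show False by simp
  qed
  have gf: "apostol_euler_gf t \<beta> x = (\<lambda>z. exp (of_real x * z) / b z powr of_real t)"
    by (auto simp: apostol_euler_gf_def b_def)
  have "b holomorphic_on ball 0 r"
    unfolding b_def by (intro holomorphic_intros)
  hence "apostol_euler_gf t \<beta> x holomorphic_on ball 0 r"
    unfolding gf using slit by (intro holomorphic_intros) force+
  hence *: "(\<lambda>n. (deriv ^^ n) (apostol_euler_gf t \<beta> x) 0 * (z ^ n / fact n))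
              sums apostol_euler_gf t \<beta> x z" if "z \<in> ball 0 r" for z
    using holomorphic_power_series[OF _ that] by (simp add: field_simps)
  have near: "\<forall>\<^sub>F z :: complex in nhds 0. z \<in> ball 0 r"
    using r by (intro eventually_nhds_in_open) auto
  define c where "c = (\<lambda>n. (deriv ^^ n) (apostol_euler_gf t \<beta> x) 0)"
  have c: "\<forall>\<^sub>F z in nhds 0. (\<lambda>n. c n * (z ^ n / fact n)) sums apostol_euler_gf t \<beta> x z"
    unfolding c_def using near * by (rule eventually_mono)
  have **: "(\<lambda>n. cnj (c n) * (z ^ n / fact n)) sums apostol_euler_gf t \<beta> x z"
    if z: "z \<in> ball 0 r" for z
  proof -
    have "cnj z \<in> ball 0 r" using z by simp
    hence "(\<lambda>n. cnj (c n * (cnj z ^ n / fact n))) sums cnj (apostol_euler_gf t \<beta> x (cnj z))"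
      unfolding sums_cnj c_def by (rule *)
    moreover have cnj_b: "b (cnj z) = cnj (b z)"
      by (simp add: b_def exp_cnj)
    have "cnj (apostol_euler_gf t \<beta> x (cnj z)) = apostol_euler_gf t \<beta> x z"
      using slit[OF z] by (simp add: gf cnj_b powr_def exp_cnj flip: cnj_Ln)
    ultimately show ?thesis by simp
  qed
  have "\<forall>\<^sub>F z in nhds 0. (\<lambda>n. cnj (c n) * (z ^ n / fact n)) sums apostol_euler_gf t \<beta> x z"
    using near ** by (rule eventually_mono)
  hence "(\<lambda>n. cnj (c n)) = c"
    using c by (rule sums_coeffs_unique)
  hence re: "c n = of_real (Re (c n))" for n
    by (metis Reals_cnj_iff of_real_Re)
  show ?thesis
  proof (rule ex1I)
    show "\<forall>\<^sub>F z in nhds 0. (\<lambda>n. of_real (Re (c n)) * (z ^ n / fact n)) sums apostol_euler_gf t \<beta> x z"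
      using c by (simp flip: re)
  next
    fix E :: "nat \<Rightarrow> real"
    assume "\<forall>\<^sub>F z :: complex in nhds 0.
              (\<lambda>n. of_real (E n) * (z ^ n / fact n)) sums apostol_euler_gf t \<beta> x z"
    hence "(\<lambda>n. of_real (E n)) = c"
      using c by (rule sums_coeffs_unique)
    thus "E = (\<lambda>n. Re (c n))"
      by auto
  qed
qed

lemma gen_apostol_euler_sums:
  "\<forall>\<^sub>F z :: complex in nhds 0.
     (\<lambda>n. of_real (gen_apostol_euler n t \<beta> x) * (z ^ n / fact n)) sums apostol_euler_gf t \<beta> x z"
  unfolding gen_apostol_euler_def by (rule theI'[OF apostol_euler_gf_ex1])

end

theory Submission
  imports Defs
begin

text \<open>
  Let \<open>B = 1 + \<beta> (e\<^sup>z - 1)\<close>, a power series with constant term 1. At a natural number \<open>t = m\<close> the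
  generating function of \<open>E\<^sub>n(m,\<beta>;x)\<close> is \<open>e\<^sup>x\<^sup>z B\<^sup>-\<^sup>m\<close> (lemma \<open>apostol_euler_fps_of_nat\<close>), and
  both identities compare coefficients of \<open>z\<^sup>n\<close> in this formal power series.

  For the first one, \<open>e\<^sup>x\<^sup>z B\<^sup>-\<^sup>m\<close> is the product of the \<open>m\<close> series \<open>e\<^bsup>x\<^sub>i z\<^esup> B\<^sup>-\<^sup>1\<close>, because the
  exponents \<open>x\<^sub>i\<close> add up to \<open>x\<close>. The coefficient of a product is a sum over all ways to distribute
  the degree \<open>n\<close> among the factors (lemma \<open>fps_prod_nth_PiE\<close>), and passing from \<open>E\<^sub>j / j!\<close> to
  \<open>E\<^sub>j\<close> produces the multinomial coefficient.

  For the second one, Newton's binomial series gives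
  \<open>B\<^sup>-\<^sup>m = \<Sum>\<^sub>k (-m gchoose k) \<beta>\<^sup>k (e\<^sup>z - 1)\<^sup>k\<close>. Multiplication by \<open>e\<^sup>z - 1\<close> acts on exponentials
  as the forward difference in \<open>x\<close>, so that the coefficient of \<open>z\<^sup>n\<close> in \<open>e\<^sup>x\<^sup>z (e\<^sup>z - 1)\<^sup>k\<close> is the
  \<open>k\<close>-th difference of \<open>y \<mapsto> y\<^sup>n\<close> at \<open>x\<close>, divided by \<open>n!\<close> (lemma \<open>fps_exp_mult_diff_power_nth\<close>).
  Only \<open>k \<le> n\<close> contributes, since \<open>(e\<^sup>z - 1)\<^sup>k\<close> starts with \<open>z\<^sup>k\<close>.
\<close>

text \<open>
  The coefficient of a product is a sum over the multisets of size \<open>n\<close> over \<open>A\<close>, and such a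
  multiset is the same thing as the function of its multiplicities.
\<close>

lemma fps_prod_nth_PiE:
  fixes f :: "'a \<Rightarrow> 'b :: comm_ring_1 fps"
  assumes "finite A"
  shows "fps_nth (\<Prod>i\<in>A. f i) n =
    (\<Sum>j\<in>{j \<in> A \<rightarrow>\<^sub>E UNIV. (\<Sum>i\<in>A. j i) = n}. \<Prod>i\<in>A. fps_nth (f i) (j i))"
proof -
  define mset_of where "mset_of j = (\<Sum>i\<in>A. replicate_mset (j i) i)" for j :: "'a \<Rightarrow> nat"
  have count: "count (mset_of j) i = (if i \<in> A then j i else 0)" for i j
    using assms by (simp add: mset_of_def count_sum)
  have size: "size X = (\<Sum>i\<in>A. count X i)" if "set_mset X \<subseteq> A" for X
    unfolding size_multiset_overloaded_eq using assms that
    by (intro sum.mono_neutral_left) (auto simp: not_in_iff)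
  show ?thesis
    unfolding fps_prod_nth'[OF assms]
  proof (rule sum.reindex_bij_witness[where j = "\<lambda>X. restrict (count X) A" and i = mset_of])
    fix X assume "X \<in> multisets_of_size A n"
    hence X: "set_mset X \<subseteq> A" "size X = n"
      by (auto simp: multisets_of_size_def)
    show "mset_of (restrict (count X) A) = X"
      using X by (auto simp: multiset_eq_iff count not_in_iff)
    show "restrict (count X) A \<in> {j \<in> A \<rightarrow>\<^sub>E UNIV. (\<Sum>i\<in>A. j i) = n}"
      using X size[of X] by auto
  next
    fix j assume "j \<in> {j \<in> A \<rightarrow>\<^sub>E UNIV. (\<Sum>i\<in>A. j i) = n}"
    hence j: "j \<in> extensional A" "(\<Sum>i\<in>A. j i) = n"
      by (auto simp: PiE_def)
    show "restrict (count (mset_of j)) A = j"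
      using j(1) by (auto simp: count extensional_def fun_eq_iff)
    have sub: "set_mset (mset_of j) \<subseteq> A"
      by (auto simp: count simp flip: count_greater_zero_iff split: if_splits)
    show "mset_of j \<in> multisets_of_size A n"
      using sub size[OF sub] j(2) by (simp add: multisets_of_size_def count)
  qed simp
qed

text \<open>
  This is \<open>a (F \<circ> g) = \<Sum>\<^sub>k F\<^sub>k (a g\<^sup>k)\<close>, read off at degree \<open>n\<close>: as \<open>g\<close> has no constant term, \<open>g\<^sup>k\<close>
  vanishes below degree \<open>k\<close> and the sum may be cut off at \<open>n\<close>.
\<close>

lemma fps_mult_compose_nth:
  fixes a F g :: "'a :: comm_ring_1 fps"
  assumes "fps_nth g 0 = 0"
  shows "fps_nth (a * (F oo g)) n = (\<Sum>k=0..n. fps_nth F k * fps_nth (a * g ^ k) n)"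
proof -
  have "fps_nth (F oo g) (n - i) = (\<Sum>k=0..n. fps_nth F k * fps_nth (g ^ k) (n - i))" for i
    unfolding fps_compose_nth using startsby_zero_power_prefix[OF assms]
    by (intro sum.mono_neutral_left) auto
  hence "fps_nth (a * (F oo g)) n =
           (\<Sum>i=0..n. \<Sum>k=0..n. fps_nth F k * (fps_nth a i * fps_nth (g ^ k) (n - i)))"
    by (simp add: fps_mult_nth sum_distrib_left mult_ac)
  also have "\<dots> = (\<Sum>k=0..n. \<Sum>i=0..n. fps_nth F k * (fps_nth a i * fps_nth (g ^ k) (n - i)))"
    by (rule sum.swap)
  finally show ?thesis
    by (simp add: fps_mult_nth sum_distrib_left)
qed

text \<open>
  The coefficients are real, but they are taken as complex numbers because the expansion that
  determines them is one of a function of a complex variable; the identities return to the reals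
  by injectivity of \<^const>\<open>of_real\<close>.
\<close>

definition apostol_euler_fps :: "real \<Rightarrow> real \<Rightarrow> real \<Rightarrow> complex fps" where
  "apostol_euler_fps t \<beta> x = Abs_fps (\<lambda>n. of_real (gen_apostol_euler n t \<beta> x) / fact n)"

lemma apostol_euler_gf_has_fps_expansion:
  "apostol_euler_gf t \<beta> x has_fps_expansion apostol_euler_fps t \<beta> x"
  using gen_apostol_euler_sums[of t \<beta> x]
  by (intro has_fps_expansionI) (simp add: apostol_euler_fps_def)

definition apostol_euler_base :: "real \<Rightarrow> complex fps" where
  "apostol_euler_base \<beta> = 1 + fps_const (of_real \<beta>) * (fps_exp 1 - 1)"

lemma apostol_euler_base_nth_0 [simp]: "fps_nth (apostol_euler_base \<beta>) 0 = 1"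
  by (simp add: apostol_euler_base_def)

text \<open>
  For \<open>m > 0\<close> the principal power with exponent \<open>m\<close> is the ordinary power everywhere, also at
  zeros of the base, so the generating function is a quotient of entire functions.
\<close>

lemma apostol_euler_fps_of_nat:
  assumes "m > 0"
  shows "apostol_euler_fps (real m) \<beta> x = fps_exp (of_real x) * inverse (apostol_euler_base \<beta>) ^ m"
proof (rule fps_expansion_unique_complex)
  show "apostol_euler_gf (real m) \<beta> x has_fps_expansion apostol_euler_fps (real m) \<beta> x"
    by (rule apostol_euler_gf_has_fps_expansion)
  have "(\<lambda>z. exp (of_real x * z) * inverse (1 + of_real \<beta> * (exp z - 1)) ^ m)
          has_fps_expansion fps_exp (of_real x) * inverse (apostol_euler_base \<beta>) ^ m"
    unfolding apostol_euler_base_def by (intro fps_expansion_intros) simp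
  moreover have "(\<lambda>z. exp (of_real x * z) * inverse (1 + of_real \<beta> * (exp z - 1)) ^ m)
                   = apostol_euler_gf (real m) \<beta> x"
    using assms by (simp add: fun_eq_iff apostol_euler_gf_def powr_nat' divide_inverse power_inverse)
  ultimately show "apostol_euler_gf (real m) \<beta> x
      has_fps_expansion fps_exp (of_real x) * inverse (apostol_euler_base \<beta>) ^ m"
    by simp
qed

lemma prod_fps_exp:
  fixes c :: "'a \<Rightarrow> 'b :: field_char_0"
  shows "(\<Prod>i\<in>A. fps_exp (c i)) = fps_exp (\<Sum>i\<in>A. c i)"
  by (induction A rule: infinite_finite_induct) (simp_all add: fps_exp_add_mult)

lemma prod_apostol_euler_fps:
  assumes "m > 0" and "(\<Sum>i=1..m. xs i) = x"
  shows "(\<Prod>i=1..m. apostol_euler_fps 1 \<beta> (xs i)) = apostol_euler_fps (real m) \<beta> x"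
proof -
  have "apostol_euler_fps 1 \<beta> y = fps_exp (of_real y) * inverse (apostol_euler_base \<beta>)" for y
    using apostol_euler_fps_of_nat[of 1 \<beta> y] by simp
  moreover have "(\<Sum>i=1..m. of_real (xs i)) = (of_real x :: complex)"
    using assms(2) by (simp flip: of_real_sum)
  ultimately show ?thesis
    using assms(1) by (simp add: apostol_euler_fps_of_nat prod.distrib prod_fps_exp)
qed

lemma multinomial_convolution_apostol_euler:
  assumes "m > 0" and "(\<Sum>i=1..m. xs i) = x"
  shows "(\<Sum>j\<in>weak_compositions m n.
            multinomial n m j * (\<Prod>i=1..m. apostol_euler (j i) \<beta> (xs i)))
         = gen_apostol_euler n (real m) \<beta> x"
proof -
  have "complex_of_real (gen_apostol_euler n (real m) \<beta> x)
          = fact n * fps_nth (\<Prod>i=1..m. apostol_euler_fps 1 \<beta> (xs i)) n"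
    unfolding prod_apostol_euler_fps[OF assms] by (simp add: apostol_euler_fps_def)
  also have "\<dots> = fact n * (\<Sum>j\<in>weak_compositions m n.
                    \<Prod>i=1..m. of_real (apostol_euler (j i) \<beta> (xs i)) / fact (j i))"
    unfolding weak_compositions_def
    by (subst fps_prod_nth_PiE) (simp_all add: apostol_euler_fps_def apostol_euler_def)
  also have "\<dots> = of_real (\<Sum>j\<in>weak_compositions m n.
                    multinomial n m j * (\<Prod>i=1..m. apostol_euler (j i) \<beta> (xs i)))"
    by (simp add: multinomial_def sum_distrib_left prod_dividef)
  finally show ?thesis
    by (simp only: of_real_eq_iff)
qed

text \<open>
  Multiplying \<open>e\<^sup>x\<^sup>z\<close> by \<open>e\<^sup>z\<close> shifts \<open>x\<close> by one, so \<open>(e\<^sup>z - 1)\<^sup>k\<close> acts as the \<open>k\<close>-th power of the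
  difference operator; the binomial theorem makes this explicit.
\<close>

lemma fps_exp_mult_diff_power_nth:
  "fps_nth (fps_exp (of_real x) * (fps_exp 1 - 1) ^ k) n =
     (of_real (fwd_diff k (\<lambda>y. y ^ n) x) / fact n :: complex)"
proof -
  have "fps_exp (of_real x) * (fps_exp 1 - 1) ^ k =
          fps_exp (of_real x) * (fps_exp 1 + (- 1 :: complex fps)) ^ k"
    by simp
  also have "\<dots> = (\<Sum>j\<le>k. fps_const (of_nat (k choose j) * (- 1) ^ (k - j)) *
                            fps_exp (of_real x + of_nat j))"
    unfolding binomial_ring sum_distrib_left
    by (intro sum.cong)
       (simp_all add: fps_exp_power_mult fps_exp_add_mult fps_of_nat mult_ac
                 flip: fps_const_mult fps_const_power fps_const_neg)
  also have "fps_nth \<dots> n = of_real (fwd_diff k (\<lambda>y. y ^ n) x) / fact n"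
    by (simp add: fps_sum_nth fwd_diff_def sum_divide_distrib atMost_atLeast0)
  finally show ?thesis .
qed

lemma of_real_gbinomial: "of_real (a gchoose k) = (of_real a gchoose k :: 'a :: {real_field, field_char_0})"
  by (simp add: gbinomial_prod_rev)

text \<open>
  Substituting \<open>\<beta> (e\<^sup>z - 1)\<close> for \<open>X\<close> in Newton's series of \<open>(1 + X)\<^sup>-\<^sup>m\<close>; the substitution is
  legitimate because \<open>e\<^sup>z - 1\<close> has no constant term.
\<close>

lemma inverse_apostol_euler_base_power:
  "inverse (apostol_euler_base \<beta>) ^ m =
     fps_binomial (- of_nat m) oo (fps_const (of_real \<beta>) * (fps_exp 1 - 1))"
proof -
  let ?g = "fps_const (of_real \<beta>) * (fps_exp 1 - 1) :: complex fps"
  have g0: "fps_nth ?g 0 = 0"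
    by simp
  have "fps_binomial (- of_nat m) oo ?g = inverse ((1 + fps_X) ^ m oo ?g)"
    unfolding fps_binomial_minus_of_nat by (rule fps_inverse_compose[OF g0]) (simp add: fps_power_zeroth)
  also have "(1 + fps_X) ^ m oo ?g = apostol_euler_base \<beta> ^ m"
    unfolding apostol_euler_base_def fps_compose_power[OF g0, symmetric]
      fps_compose_add_distrib fps_X_fps_compose_startby0[OF g0] fps_compose_1 ..
  finally show ?thesis
    by (simp add: fps_inverse_power)
qed

lemma gen_apostol_euler_of_nat_fwd_diff:
  assumes "m > 0"
  shows "gen_apostol_euler n (real m) \<beta> x
         = (\<Sum>k=0..n. ((- real m) gchoose k) * \<beta> ^ k * fwd_diff k (\<lambda>y. y ^ n) x)"
proof -
  let ?g = "fps_const (of_real \<beta>) * (fps_exp 1 - 1) :: complex fps"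
  have coeff: "fps_nth (fps_exp (of_real x) * ?g ^ k) n =
                 of_real \<beta> ^ k * (of_real (fwd_diff k (\<lambda>y. y ^ n) x) / fact n)" for k
  proof -
    have "fps_exp (of_real x) * ?g ^ k =
            fps_const (of_real \<beta> ^ k) * (fps_exp (of_real x) * (fps_exp 1 - 1) ^ k)"
      by (simp add: power_mult_distrib mult_ac flip: fps_const_power)
    thus ?thesis
      by (simp only: fps_mult_left_const_nth fps_exp_mult_diff_power_nth)
  qed
  have "complex_of_real (gen_apostol_euler n (real m) \<beta> x)
          = fact n * fps_nth (apostol_euler_fps (real m) \<beta> x) n"
    by (simp add: apostol_euler_fps_def)
  also have "\<dots> = fact n * fps_nth (fps_exp (of_real x) * (fps_binomial (- of_nat m) oo ?g)) n"
    by (simp add: apostol_euler_fps_of_nat[OF assms] inverse_apostol_euler_base_power)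
  also have "\<dots> = fact n * (\<Sum>k=0..n. (- of_nat m gchoose k) *
                    (of_real \<beta> ^ k * (of_real (fwd_diff k (\<lambda>y. y ^ n) x) / fact n)))"
    by (subst fps_mult_compose_nth) (simp_all only: coeff fps_binomial_nth, simp)
  also have "\<dots> = of_real (\<Sum>k=0..n. ((- real m) gchoose k) * \<beta> ^ k * fwd_diff k (\<lambda>y. y ^ n) x)"
    by (simp add: sum_distrib_left of_real_gbinomial mult_ac)
  finally show ?thesis
    by (simp only: of_real_eq_iff)
qed

theorem theorem8:
  fixes \<beta> x :: real and xs :: "nat \<Rightarrow> real" and m n :: nat
  assumes "0 \<le> \<beta>" and "\<beta> \<le> 1"
    and "m \<ge> 1"
    and "(\<Sum>i=1..m. xs i) = x"
  shows "(\<Sum>j\<in>weak_compositions m n.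
            multinomial n m j * (\<Prod>i=1..m. apostol_euler (j i) \<beta> (xs i)))
         = gen_apostol_euler n (real m) \<beta> x
       \<and> gen_apostol_euler n (real m) \<beta> x
         = (\<Sum>k=0..n. ((- real m) gchoose k) * \<beta> ^ k * fwd_diff k (\<lambda>y. y ^ n) x)"
  using multinomial_convolution_apostol_euler gen_apostol_euler_of_nat_fwd_diff assms(3,4) by simp

end
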